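(* Let $G$ be a countably infinite discrete group. Suppose $H\leq G$ has finite index and the set of all distal points is dense in $(2^H, H)$. Then the set of all distal points is dense in $(2^G, G)$.
   Context: For a countable discrete group $K$, $2^K=\{0,1\}^K$ carries the product topology and $(2^K,K)$ denotes the Bernoulli right-shift, where $K$ acts by $(g\cdot x)(h)=x(hg)$ for $g,h\in K$, $x\in 2^K$. For a continuous action of $K$ on a compact metrizable space $X$ with compatible metric $d$, points $x,y\in X$ are proximal if there is a sequence $\{g_n\}$ in $K$ with $d(g_nx,g_ny)\to 0$ (this does not depend on $d$), and $x$ is distal if it is not proximal to any other point of its orbit closure $\overline{Kx}$. *)

theory Defs
  imports "HOL-Analysis.Analysis" "HOL-Algebra.Coset"
begin

text \<open>
  A map \<open>act\<close> sends a group element and a point to a point; \<open>K\<close> is the acting group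
  (only its carrier matters below) and \<open>X\<close> the space acted upon.
  For compact metrizable \<open>X\<close>, proximality does not depend on the choice of the compatible
  metric \<open>d\<close>, so quantifying it existentially is harmless.
\<close>

definition proximal ::
  "('g, 'm) monoid_scheme \<Rightarrow> 'x topology \<Rightarrow> ('g \<Rightarrow> 'x \<Rightarrow> 'x) \<Rightarrow> 'x \<Rightarrow> 'x \<Rightarrow> bool" where
  "proximal K X act x y \<longleftrightarrow>
     x \<in> topspace X \<and> y \<in> topspace X \<and>
     (\<exists>d. Metric_space (topspace X) d \<and> Metric_space.mtopology (topspace X) d = X \<and>
        (\<exists>g :: nat \<Rightarrow> 'g. (\<forall>n. g n \<in> carrier K) \<and>
           (\<lambda>n. d (act (g n) x) (act (g n) y)) \<longlonglongrightarrow> 0))"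

definition orbit_closure ::
  "('g, 'm) monoid_scheme \<Rightarrow> 'x topology \<Rightarrow> ('g \<Rightarrow> 'x \<Rightarrow> 'x) \<Rightarrow> 'x \<Rightarrow> 'x set" where
  "orbit_closure K X act x = X closure_of ((\<lambda>g. act g x) ` carrier K)"

definition distal_point ::
  "('g, 'm) monoid_scheme \<Rightarrow> 'x topology \<Rightarrow> ('g \<Rightarrow> 'x \<Rightarrow> 'x) \<Rightarrow> 'x \<Rightarrow> bool" where
  "distal_point K X act x \<longleftrightarrow>
     x \<in> topspace X \<and> (\<forall>y \<in> orbit_closure K X act x. y \<noteq> x \<longrightarrow> \<not> proximal K X act x y)"

definition distal_points_dense ::
  "('g, 'm) monoid_scheme \<Rightarrow> 'x topology \<Rightarrow> ('g \<Rightarrow> 'x \<Rightarrow> 'x) \<Rightarrow> bool" where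
  "distal_points_dense K X act \<longleftrightarrow> X closure_of {x. distal_point K X act x} = topspace X"

text \<open>
  The Bernoulli right-shift. \<open>bool\<close> plays the role of \<open>{0,1}\<close>; points of the product are
  functions equal to \<open>undefined\<close> outside the carrier, whence the restricted abstraction in
  the action.
\<close>

definition bernoulli_space :: "('g, 'm) monoid_scheme \<Rightarrow> ('g \<Rightarrow> bool) topology" where
  "bernoulli_space K = product_topology (\<lambda>_. discrete_topology (UNIV :: bool set)) (carrier K)"

definition bernoulli_shift ::
  "('g, 'm) monoid_scheme \<Rightarrow> 'g \<Rightarrow> ('g \<Rightarrow> bool) \<Rightarrow> ('g \<Rightarrow> bool)" where
  "bernoulli_shift K g x = (\<lambda>h \<in> carrier K. x (h \<otimes>\<^bsub>K\<^esub> g))"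

end

theory Submission
  imports Defs
begin

text \<open>
  As an \<open>H\<close>-space, \<open>2\<^sup>G\<close> is the product of copies of \<open>2\<^sup>H\<close>, one for each left coset
  \<open>tH\<close>: the factor map sends \<open>x\<close> to \<open>h \<mapsto> x (th)\<close>, and it is equivariant because the
  shift multiplies on the right. A point of a product all of whose coordinates are distal is itself
  distal, since proximality and membership in an orbit closure both pass to factors
  (\<open>distal_point_of_separating_factors\<close>). A basic open set of \<open>2\<^sup>G\<close> restricts each
  coordinate separately, so by density of the distal points of \<open>2\<^sup>H\<close> it contains a
  point whose restriction to every left coset is a distal point of \<open>2\<^sup>H\<close>. Such a point is distal for the action of \<open>H\<close>.

  It remains to pass from \<open>H\<close> to \<open>G\<close> (\<open>distal_point_of_finite_index\<close>). Let \<open>N\<close> be the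
  normal core of \<open>H\<close>, which again has finite index, and let \<open>x\<close> be \<open>N\<close>-distal. Suppose that
  \<open>y\<close> lies in the \<open>G\<close>-orbit closure of \<open>x\<close> and is \<open>G\<close>-proximal to \<open>x\<close>. Finitely many
  cosets of \<open>N\<close> cover \<open>G\<close>, so \<open>x\<close> and \<open>y\<close> are already \<open>N\<close>-proximal, and \<open>y\<close> lies in
  the \<open>N\<close>-orbit closure of some translate \<open>sx\<close>. The difficulty is that this does not yet put
  \<open>y\<close> into the \<open>N\<close>-orbit closure of \<open>x\<close> itself, which is what distality of \<open>x\<close> speaks about. Here
  minimality helps. A distal point has a minimal orbit closure; by normality so does \<open>sx\<close>, and
  therefore so does \<open>y\<close>. By proximality the \<open>N\<close>-orbit closures of \<open>x\<close> and \<open>y\<close> have a common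
  point, and two minimal sets that meet coincide. So \<open>y\<close> is in the \<open>N\<close>-orbit closure of
  \<open>x\<close>, whence \<open>y = x\<close>.

  That distal points are minimal is the theorem of Auslander and Ellis
  (\<open>proximal_to_minimal_point\<close>): every point is proximal to a minimal point of its orbit
  closure. The minimal point is \<open>u x\<close>, for an idempotent \<open>u\<close> in a minimal left ideal of the
  closure of the acting group in the space of all self-maps of \<open>X\<close> with the product topology.

  All of this is topological once proximality is expressed without a metric: \<open>x\<close> and \<open>y\<close> are
  proximal iff the orbit of \<open>(x, y)\<close> under the diagonal action accumulates at the diagonal
  (\<open>proximal_iff_closure_meets_diagonal\<close>).
\<close>

section \<open>Minimal closed sets and idempotents\<close>

text \<open>
  Zorn's lemma for reverse inclusion: the intersection of a chain of nonempty closed sets is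
  nonempty by compactness, so it suffices that the family is closed under nonempty intersections.
  It supplies both the minimal left ideal and the minimal closed subsemigroup used below.
\<close>

lemma exists_minimal_closed_member:
  assumes "compact_space X"
    and "S \<in> F"
    and closed: "\<And>A. A \<in> F \<Longrightarrow> closedin X A \<and> A \<noteq> {}"
    and Inter: "\<And>C. C \<subseteq> F \<Longrightarrow> C \<noteq> {} \<Longrightarrow> \<Inter>C \<noteq> {} \<Longrightarrow> \<Inter>C \<in> F"
  obtains M where "M \<in> F" "\<And>A. A \<in> F \<Longrightarrow> A \<subseteq> M \<Longrightarrow> A = M"
proof -
  let ?P = "\<lambda>A B :: 'a set. B \<subseteq> A"
  have "\<exists>u\<in>F. \<forall>a\<in>C. u \<subseteq> a" if C: "C \<in> Chains (relation_of ?P F)" for C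
  proof (cases "C = {}")
    case True
    then show ?thesis using assms(2) by blast
  next
    case False
    have CF: "C \<subseteq> F" and chain: "\<And>A B. A \<in> C \<Longrightarrow> B \<in> C \<Longrightarrow> A \<subseteq> B \<or> B \<subseteq> A"
      using C unfolding Chains_def relation_of_def by auto
    have fin: "\<Inter>D \<in> D" if "finite D" "D \<noteq> {}" "D \<subseteq> C" for D
      using that
    proof (induction D rule: finite_ne_induct)
      case (insert A D)
      then have "\<Inter>D \<subseteq> A \<or> A \<subseteq> \<Inter>D"
        using chain by (metis insert_subset subsetD)
      then show ?case
        using insert by (auto simp: Int_absorb1 Int_absorb2)
    qed simp
    have "\<Inter>D \<noteq> {}" if "finite D" "D \<subseteq> C" for D
      using fin[OF that(1)] that CF closed by (cases "D = {}") auto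
    then have "\<Inter>C \<noteq> {}"
      using assms(1) closed CF unfolding compact_space_fip by (metis subsetD)
    then show ?thesis
      using Inter[OF CF False] by blast
  qed
  moreover have "partial_order_on F (relation_of ?P F)"
    by (auto simp: partial_order_on_def preorder_on_def relation_of_def refl_on_def trans_def antisym_def)
  ultimately have "\<exists>m\<in>F. \<forall>a\<in>F. a \<subseteq> m \<longrightarrow> a = m"
    by (intro predicate_Zorn)
  then show ?thesis
    using that by blast
qed

text \<open>
  The Ellis-Numakura lemma. In a minimal closed subsemigroup \<open>S\<close>, take any \<open>s\<close>. The set
  \<open>Ss\<close> is a closed subsemigroup, so \<open>Ss = S\<close>; hence \<open>{t \<in> S. ts = s}\<close> is nonempty, and it is
  again a closed subsemigroup, so it contains \<open>s\<close>. Continuity is asked of \<open>p \<mapsto> pq\<close> only, since that is what holds for composition of maps that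
  need not be continuous, in the topology of pointwise convergence.
\<close>

lemma compact_semigroup_has_idempotent:
  fixes op :: "'a \<Rightarrow> 'a \<Rightarrow> 'a"
  assumes "compact_space X" "Hausdorff_space X"
    and L: "closedin X L" "L \<noteq> {}"
    and op_closed: "\<And>p q. p \<in> L \<Longrightarrow> q \<in> L \<Longrightarrow> op p q \<in> L"
    and assoc: "\<And>p q r. p \<in> L \<Longrightarrow> q \<in> L \<Longrightarrow> r \<in> L \<Longrightarrow> op (op p q) r = op p (op q r)"
    and cont: "\<And>q. q \<in> L \<Longrightarrow> continuous_map X X (\<lambda>p. op p q)"
  obtains u where "u \<in> L" "op u u = u"
proof -
  define F where "F = {A. closedin X A \<and> A \<noteq> {} \<and> A \<subseteq> L \<and> (\<forall>p\<in>A. \<forall>q\<in>A. op p q \<in> A)}"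
  have LF: "L \<in> F"
    using L op_closed by (auto simp: F_def)
  have FI: "\<Inter>C \<in> F" if "C \<subseteq> F" "C \<noteq> {}" "\<Inter>C \<noteq> {}" for C
  proof -
    have "closedin X (\<Inter>C)"
      using that by (intro closedin_Inter) (auto simp: F_def)
    then show ?thesis
      using that unfolding F_def by blast
  qed
  have FC: "closedin X A \<and> A \<noteq> {}" if "A \<in> F" for A
    using that by (simp add: F_def)
  obtain S where S: "S \<in> F" and min: "\<And>A. A \<in> F \<Longrightarrow> A \<subseteq> S \<Longrightarrow> A = S"
    using exists_minimal_closed_member[OF assms(1) LF FC FI] by blast
  obtain s where s: "s \<in> S"
    using S by (auto simp: F_def)
  have SL: "S \<subseteq> L" and Sop: "\<And>p q. p \<in> S \<Longrightarrow> q \<in> S \<Longrightarrow> op p q \<in> S" and Scl: "closedin X S"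
    using S by (auto simp: F_def)
  have cs: "continuous_map X X (\<lambda>p. op p s)"
    using cont s SL by blast
  have "(\<lambda>p. op p s) ` S \<in> F"
  proof -
    have "closedin X ((\<lambda>p. op p s) ` S)"
      using image_compactin[OF closedin_compact_space[OF assms(1) Scl] cs]
      by (rule compactin_imp_closedin[OF assms(2)])
    moreover have "op (op p s) (op q s) \<in> (\<lambda>p. op p s) ` S" if "p \<in> S" "q \<in> S" for p q
    proof -
      have "op (op p s) (op q s) = op (op (op p s) q) s"
        using assoc[of "op p s" q s] Sop SL s that by (metis subsetD)
      then show ?thesis
        using Sop s that by auto
    qed
    ultimately show ?thesis
      using s Sop SL by (auto simp: F_def)
  qed
  then have "(\<lambda>p. op p s) ` S = S"
    using min Sop s by blast
  then obtain t where t: "t \<in> S" "op t s = s"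
    using s by (metis imageE)
  have "{t \<in> S. op t s = s} \<in> F"
  proof -
    have "closedin X {s}"
      using closedin_Hausdorff_sing_eq[OF assms(2)] s Scl closedin_subset by blast
    then have "closedin X {t \<in> topspace X. op t s \<in> {s}}"
      by (rule closedin_continuous_map_preimage[OF cs])
    then have "closedin X (S \<inter> {t \<in> topspace X. op t s \<in> {s}})"
      using Scl by blast
    moreover have "S \<inter> {t \<in> topspace X. op t s \<in> {s}} = {t \<in> S. op t s = s}"
      using closedin_subset[OF Scl] by auto
    moreover have "op (op p q) s = s" if "p \<in> S" "op p s = s" "q \<in> S" "op q s = s" for p q
      using assoc[of p q s] that s SL by (metis subsetD)
    ultimately show ?thesis
      using t Sop SL by (auto simp: F_def)
  qed
  then have "{t \<in> S. op t s = s} = S"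
    using min by blast
  then show ?thesis
    using that s SL by blast
qed

section \<open>Actions on compact metrizable spaces\<close>

locale compact_metrizable_action = group K for K :: "('g, 'm) monoid_scheme" (structure) +
  fixes X :: "'x topology" and act :: "'g \<Rightarrow> 'x \<Rightarrow> 'x"
  assumes compact: "compact_space X"
    and metrizable: "metrizable_space X"
    and continuous_act: "g \<in> carrier K \<Longrightarrow> continuous_map X X (act g)"
    and act_mult: "g \<in> carrier K \<Longrightarrow> h \<in> carrier K \<Longrightarrow> x \<in> topspace X \<Longrightarrow>
      act (g \<otimes> h) x = act g (act h x)"
    and act_one: "x \<in> topspace X \<Longrightarrow> act \<one> x = x"
begin

lemma Hausdorff: "Hausdorff_space X"
  using metrizable by (rule metrizable_imp_Hausdorff_space)

lemma act_closed: "g \<in> carrier K \<Longrightarrow> x \<in> topspace X \<Longrightarrow> act g x \<in> topspace X"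
  using continuous_act continuous_map_image_subset_topspace by fastforce

lemma act_inv_cancel: "g \<in> carrier K \<Longrightarrow> x \<in> topspace X \<Longrightarrow> act (inv g) (act g x) = x"
  using act_mult[of "inv g" g x] act_one by simp

abbreviation cl_orbit :: "'x \<Rightarrow> 'x set" where
  "cl_orbit \<equiv> orbit_closure K X act"

definition pair_orbit :: "'x \<Rightarrow> 'x \<Rightarrow> ('x \<times> 'x) set" where
  "pair_orbit x y = (\<lambda>g. (act g x, act g y)) ` carrier K"

lemma orbit_closure_subset: "cl_orbit x \<subseteq> topspace X"
  unfolding orbit_closure_def by (rule closure_of_subset_topspace)

lemma closedin_orbit_closure: "closedin X (cl_orbit x)"
  unfolding orbit_closure_def by simp

lemma orbit_subset_closure: 
  assumes "x \<in> topspace X" "g \<in> carrier K" shows "act g x \<in> cl_orbit x"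
proof -
  have "(\<lambda>g. act g x) ` carrier K \<subseteq> topspace X"
    using act_closed assms by blast
  from closure_of_subset[OF this] show ?thesis
    using assms unfolding orbit_closure_def by blast
qed

lemma self_in_orbit_closure: "x \<in> topspace X \<Longrightarrow> x \<in> cl_orbit x"
  using orbit_subset_closure[of x \<one>] act_one by simp

lemma orbit_closure_invariant:
  assumes "x \<in> topspace X" "y \<in> cl_orbit x" "g \<in> carrier K"
  shows "act g y \<in> cl_orbit x"
proof -
  have "act g ` (X closure_of (\<lambda>g. act g x) ` carrier K)
      \<subseteq> X closure_of (act g ` (\<lambda>g. act g x) ` carrier K)"
    by (rule continuous_map_image_closure_subset[OF continuous_act[OF assms(3)]])
  also have "act g ` (\<lambda>g. act g x) ` carrier K \<subseteq> (\<lambda>g. act g x) ` carrier K"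
    using assms by (auto simp: act_mult[symmetric])
  then have "X closure_of (act g ` (\<lambda>g. act g x) ` carrier K) \<subseteq> X closure_of (\<lambda>g. act g x) ` carrier K"
    by (rule closure_of_mono)
  finally show ?thesis
    using assms(2) unfolding orbit_closure_def by blast
qed

lemma orbit_closure_minimal:
  assumes "closedin X A" "\<And>g. g \<in> carrier K \<Longrightarrow> act g y \<in> A"
  shows "cl_orbit y \<subseteq> A"
  unfolding orbit_closure_def using assms by (intro closure_of_minimal) auto

lemma orbit_closure_trans:
  assumes "x \<in> topspace X" "y \<in> cl_orbit x"
  shows "cl_orbit y \<subseteq> cl_orbit x"
  using assms by (intro orbit_closure_minimal closedin_orbit_closure orbit_closure_invariant)

text \<open>
  If \<open>d (g\<^sub>n x) (g\<^sub>n y)\<close> tends to 0, compactness gives a subsequence along which \<open>g\<^sub>n x\<close>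
  converges, and \<open>g\<^sub>n y\<close> then has the same limit. Conversely, near an accumulation point
  on the diagonal both coordinates are close to the same point, for any compatible metric.
\<close>

lemma proximal_iff_closure_meets_diagonal:
  "proximal K X act x y \<longleftrightarrow> x \<in> topspace X \<and> y \<in> topspace X \<and>
     (\<exists>z. (z, z) \<in> prod_topology X X closure_of pair_orbit x y)"
  (is "?l \<longleftrightarrow> ?r")
proof
  assume ?l
  then obtain d g where xy: "x \<in> topspace X" "y \<in> topspace X"
    and d: "Metric_space (topspace X) d" and dX: "Metric_space.mtopology (topspace X) d = X"
    and g: "\<And>n::nat. g n \<in> carrier K" and lim: "(\<lambda>n. d (act (g n) x) (act (g n) y)) \<longlonglongrightarrow> 0"
    unfolding proximal_def by blast
  interpret M: Metric_space "topspace X" d by fact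
  have "range (\<lambda>n. act (g n) x) \<subseteq> topspace X"
    using act_closed g xy by blast
  then obtain z r where z: "z \<in> topspace X" and r: "strict_mono (r :: nat \<Rightarrow> nat)"
    and rx: "limitin M.mtopology ((\<lambda>n. act (g n) x) \<circ> r) z sequentially"
    using compact M.compact_space_sequentially unfolding dX by blast
  have rx': "(\<lambda>n. d (act (g (r n)) x) z) \<longlonglongrightarrow> 0"
    using rx unfolding M.limitin_metric_dist_null by (simp add: o_def)
  have rxy: "(\<lambda>n. d (act (g (r n)) x) (act (g (r n)) y)) \<longlonglongrightarrow> 0"
    using LIMSEQ_subseq_LIMSEQ[OF lim r] by (simp add: o_def)
  have ry': "(\<lambda>n. d (act (g (r n)) y) z) \<longlonglongrightarrow> 0"
  proof (rule tendsto_sandwich[OF _ _ tendsto_const])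
    show "(\<lambda>n. d (act (g (r n)) x) (act (g (r n)) y) + d (act (g (r n)) x) z) \<longlonglongrightarrow> 0"
      using tendsto_add[OF rxy rx'] by simp
    show "\<forall>\<^sub>F n in sequentially. d (act (g (r n)) y) z
        \<le> d (act (g (r n)) x) (act (g (r n)) y) + d (act (g (r n)) x) z"
      using M.triangle M.commute act_closed g xy z by (intro always_eventually allI) metis
  qed simp
  have rx2: "limitin X (\<lambda>n. act (g (r n)) x) z sequentially"
    using rx by (simp add: dX o_def)
  have ry2: "limitin X (\<lambda>n. act (g (r n)) y) z sequentially"
    using ry' M.limitin_metric_dist_null[of "\<lambda>n. act (g (r n)) y" z sequentially] z act_closed g xy
    by (simp add: dX)
  have "limitin (prod_topology X X) (\<lambda>n. (act (g (r n)) x, act (g (r n)) y)) (z, z) sequentially"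
    using rx2 ry2 by (simp add: limitin_pairwise o_def)
  moreover have "(act (g (r n)) x, act (g (r n)) y) \<in> pair_orbit x y" for n
    using g by (auto simp: pair_orbit_def)
  ultimately have "(z, z) \<in> prod_topology X X closure_of pair_orbit x y"
    unfolding in_closure_of limitin_def eventually_sequentially using z
    by (metis SigmaI order_refl topspace_prod_topology)
  with xy show ?r by blast
next
  assume ?r
  then obtain z where xy: "x \<in> topspace X" "y \<in> topspace X"
    and z: "(z, z) \<in> prod_topology X X closure_of pair_orbit x y" by blast
  obtain M d where "Metric_space M d" and dX: "X = Metric_space.mtopology M d"
    using metrizable unfolding metrizable_space_def by blast
  then have MX: "M = topspace X"
    by (simp add: Metric_space.topspace_mtopology)
  interpret M: Metric_space M d by fact
  have zM: "z \<in> M"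
    using z unfolding in_closure_of MX by auto
  have "\<exists>g. g \<in> carrier K \<and> d (act g x) (act g y) < 2 * inverse (Suc n)" for n
  proof -
    have "openin (prod_topology X X) (M.mball z (inverse (Suc n)) \<times> M.mball z (inverse (Suc n)))"
      unfolding dX openin_prod_Times_iff by auto
    moreover have "(z, z) \<in> M.mball z (inverse (Suc n)) \<times> M.mball z (inverse (Suc n))"
      using zM by simp
    ultimately obtain p where "p \<in> pair_orbit x y"
      and "p \<in> M.mball z (inverse (Suc n)) \<times> M.mball z (inverse (Suc n))"
      using z unfolding in_closure_of by meson
    then obtain g where g: "g \<in> carrier K" and "act g x \<in> M.mball z (inverse (Suc n))"
      "act g y \<in> M.mball z (inverse (Suc n))"
      unfolding pair_orbit_def by blast
    then have "d z (act g x) < inverse (Suc n)" "d z (act g y) < inverse (Suc n)"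
      "act g x \<in> M" "act g y \<in> M" by auto
    then show ?thesis
      using g M.triangle''[of "act g x" z "act g y"] M.triangle[of "act g x" z "act g y"] M.commute zM
      by (intro exI[of _ g]) (smt (verit))
  qed
  then obtain g where g: "\<And>n. g n \<in> carrier K"
    and gd: "\<And>n. d (act (g n) x) (act (g n) y) < 2 * inverse (Suc n)" by metis
  have "(\<lambda>n. d (act (g n) x) (act (g n) y)) \<longlonglongrightarrow> 0"
  proof (rule tendsto_sandwich[OF _ _ tendsto_const])
    show "(\<lambda>n. 2 * inverse (real (Suc n))) \<longlonglongrightarrow> 0"
      using tendsto_mult_right_zero[OF LIMSEQ_inverse_real_of_nat] by simp
  qed (use gd in \<open>auto intro!: always_eventually less_imp_le\<close>)
  then show ?l
    unfolding proximal_def using xy \<open>Metric_space M d\<close> dX[symmetric] g unfolding MX by blast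
qed

section \<open>Distal points are minimal\<close>

text \<open>
  Membership of \<open>x\<close> in the closure of the orbit of every point of its own orbit closure says
  that this orbit closure has no proper nonempty closed invariant subset.
\<close>

definition minimal_point :: "'x \<Rightarrow> bool" where
  "minimal_point x \<longleftrightarrow> x \<in> topspace X \<and> (\<forall>y \<in> cl_orbit x. x \<in> cl_orbit y)"

text \<open>
  The Auslander-Ellis theorem. The enveloping semigroup \<open>E\<close> is the closure of the acting group
  in the space \<open>P\<close> of all self-maps of \<open>X\<close>, and \<open>L\<close> is a minimal left ideal of \<open>E\<close>.
  Evaluation at \<open>x\<close> carries \<open>L\<close> onto a minimal closed invariant subset of the orbit closure of \<open>x\<close>.
  An idempotent \<open>u\<close> of \<open>L\<close> satisfies \<open>u x = u (u x)\<close>; as \<open>u\<close> is a pointwise limit of group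
  elements, this puts \<open>(u x, u x)\<close> in the closure of the orbit of \<open>(x, u x)\<close>.
\<close>

lemma proximal_to_minimal_point:
  assumes x: "x \<in> topspace X"
  obtains y where "y \<in> cl_orbit x" "minimal_point y" "proximal K X act x y"
proof -
  define S where "S = topspace X"
  define P where "P = product_topology (\<lambda>_. X) S"
  have cP: "compact_space P" and hP: "Hausdorff_space P"
    using compact Hausdorff by (auto simp: P_def compact_space_product_topology Hausdorff_space_product_topology)
  have P_fun: "p s \<in> S" if "p \<in> topspace P" "s \<in> S" for p s
    using that by (auto simp: P_def S_def)
  have ev: "continuous_map P X (\<lambda>p. p s)" if "s \<in> S" for s
    unfolding P_def using that by (rule continuous_map_product_projection)
  have cont_right: "continuous_map P P (\<lambda>p. compose S p q)" if "q \<in> topspace P" for q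
    unfolding P_def continuous_map_componentwise
  proof (intro conjI ballI)
    fix s assume "s \<in> S"
    then show "continuous_map (product_topology (\<lambda>_. X) S) X (\<lambda>p. compose S p q s)"
      using ev[OF P_fun[OF that]] by (simp add: compose_def P_def)
  qed (auto simp: compose_def)
  have cont_left: "continuous_map P P (compose S (act g))" if "g \<in> carrier K" for g
    unfolding P_def continuous_map_componentwise
  proof (intro conjI ballI)
    fix s assume "s \<in> S"
    then show "continuous_map (product_topology (\<lambda>_. X) S) X (\<lambda>p. compose S (act g) p s)"
      using continuous_map_compose[OF ev[of s] continuous_act[OF that]] by (simp add: compose_def P_def o_def)
  qed (auto simp: compose_def)
  define R where "R = (\<lambda>g. restrict (act g) S) ` carrier K"
  define E where "E = P closure_of R"
  have RP: "R \<subseteq> topspace P"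
    using act_closed by (auto simp: R_def P_def S_def)
  have EP: "E \<subseteq> topspace P" and clE: "closedin P E"
    unfolding E_def by (simp_all add: closure_of_subset_topspace)
  define F where "F = {A. closedin P A \<and> A \<noteq> {} \<and> A \<subseteq> E \<and> (\<forall>g\<in>carrier K. \<forall>q\<in>A. compose S (act g) q \<in> A)}"
  have EF: "E \<in> F"
  proof -
    have "compose S (act g) q \<in> E" if g: "g \<in> carrier K" and q: "q \<in> E" for g q
    proof -
      have "compose S (act g) ` E \<subseteq> P closure_of (compose S (act g) ` R)"
        unfolding E_def by (rule continuous_map_image_closure_subset[OF cont_left[OF g]])
      also have "compose S (act g) ` R \<subseteq> R"
      proof clarify
        fix p assume "p \<in> R"
        then obtain h where h: "h \<in> carrier K" "p = restrict (act h) S" by (auto simp: R_def)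
        then have "compose S (act g) p = restrict (act (g \<otimes> h)) S"
          using g by (auto simp: compose_def S_def act_mult)
        then show "compose S (act g) p \<in> R"
          using g h by (auto simp: R_def)
      qed
      then have "P closure_of (compose S (act g) ` R) \<subseteq> E"
        unfolding E_def by (rule closure_of_mono)
      finally show ?thesis using q by blast
    qed
    moreover have "E \<noteq> {}"
      unfolding E_def using closure_of_subset[OF RP] by (auto simp: R_def)
    ultimately show ?thesis
      using clE by (auto simp: F_def)
  qed
  have FI: "\<Inter>C \<in> F" if "C \<subseteq> F" "C \<noteq> {}" "\<Inter>C \<noteq> {}" for C
  proof -
    have "closedin P (\<Inter>C)"
      using that by (intro closedin_Inter) (auto simp: F_def)
    then show ?thesis
      using that unfolding F_def by blast
  qed
  have FC: "closedin P A \<and> A \<noteq> {}" if "A \<in> F" for A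
    using that by (simp add: F_def)
  obtain L where L: "L \<in> F" and min: "\<And>A. A \<in> F \<Longrightarrow> A \<subseteq> L \<Longrightarrow> A = L"
    using exists_minimal_closed_member[OF cP EF FC FI] by blast
  have clL: "closedin P L" and LE: "L \<subseteq> E" and Lne: "L \<noteq> {}"
    and Lact: "\<And>g q. g \<in> carrier K \<Longrightarrow> q \<in> L \<Longrightarrow> compose S (act g) q \<in> L"
    using L by (auto simp: F_def)
  \<comment> \<open>Invariance under the group passes to its closure because composition is continuous in the
    left argument.\<close>
  have EL: "compose S p q \<in> L" if p: "p \<in> E" and q: "q \<in> L" for p q
  proof -
    have qP: "q \<in> topspace P" using q LE EP by blast
    have "closedin P {p \<in> topspace P. compose S p q \<in> L}"
      by (rule closedin_continuous_map_preimage[OF cont_right[OF qP] clL])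
    moreover have "R \<subseteq> {p \<in> topspace P. compose S p q \<in> L}"
    proof
      fix p assume pR: "p \<in> R"
      then obtain g where g: "g \<in> carrier K" "p = restrict (act g) S" by (auto simp: R_def)
      then have "compose S p q = compose S (act g) q"
        using P_fun[OF qP] by (auto simp: compose_def)
      then show "p \<in> {p \<in> topspace P. compose S p q \<in> L}"
        using Lact g q pR RP by auto
    qed
    ultimately have "E \<subseteq> {p \<in> topspace P. compose S p q \<in> L}"
      unfolding E_def by (rule closure_of_minimal[rotated])
    then show ?thesis using p by blast
  qed
  have LP: "L \<subseteq> topspace P" using LE EP by blast
  have assoc: "compose S (compose S p q) r = compose S p (compose S q r)"
    if "p \<in> L" "q \<in> L" "r \<in> L" for p q r
    using P_fun that LP by (auto simp: compose_def fun_eq_iff subset_iff)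
  have LL: "compose S p q \<in> L" if "p \<in> L" "q \<in> L" for p q
    using EL that LE by blast
  have cont_L: "continuous_map P P (\<lambda>p. compose S p q)" if "q \<in> L" for q
    using cont_right that LP by blast
  obtain u where u: "u \<in> L" and uu: "compose S u u = u"
    by (rule compact_semigroup_has_idempotent[OF cP hP clL Lne LL assoc cont_L])
  have xS: "x \<in> S" using x by (simp add: S_def)
  define y where "y = u x"
  have yS: "y \<in> S" and yX: "y \<in> topspace X" 
    using P_fun u LP xS by (auto simp: y_def S_def)
  have uy: "u y = y"
    using fun_cong[OF uu, of x] xS by (simp add: compose_def y_def)
  have orb: "p z \<in> cl_orbit z" if "p \<in> E" "z \<in> S" for p z
  proof -
    have "(\<lambda>p. p z) ` E \<subseteq> X closure_of ((\<lambda>p. p z) ` R)"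
      unfolding E_def by (rule continuous_map_image_closure_subset[OF ev[OF that(2)]])
    also have "(\<lambda>p. p z) ` R = (\<lambda>g. act g z) ` carrier K"
      using that(2) by (auto simp: R_def image_image)
    finally show ?thesis using that(1) by (auto simp: orbit_closure_def)
  qed
  have "(y, y) \<in> prod_topology X X closure_of pair_orbit x y"
  proof -
    have "continuous_map P (prod_topology X X) (\<lambda>p. (p x, p y))"
      using ev xS yS by (intro continuous_map_pairedI) auto
    then have "(\<lambda>p. (p x, p y)) ` E \<subseteq> prod_topology X X closure_of ((\<lambda>p. (p x, p y)) ` R)"
      unfolding E_def by (rule continuous_map_image_closure_subset)
    also have "(\<lambda>p. (p x, p y)) ` R = pair_orbit x y"
      using xS yS by (auto simp: R_def image_image pair_orbit_def)
    finally have "(\<lambda>p. (p x, p y)) ` E \<subseteq> prod_topology X X closure_of pair_orbit x y" .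
    moreover have "(u x, u y) \<in> (\<lambda>p. (p x, p y)) ` E" using u LE by blast
    ultimately show ?thesis using uy by (auto simp: y_def)
  qed
  then have "proximal K X act x y"
    using x yX proximal_iff_closure_meets_diagonal by blast
  moreover have "y \<in> cl_orbit x"
    using orb u LE xS by (auto simp: y_def)
  moreover have "minimal_point y"
    unfolding minimal_point_def
  proof (intro conjI ballI yX)
    fix w assume w: "w \<in> cl_orbit y"
    have wX: "w \<in> topspace X" using w orbit_closure_subset by blast
    \<comment> \<open>The elements of \<open>L\<close> sending \<open>x\<close> into the closed invariant set \<open>cl_orbit w\<close> form a left
      ideal, so by minimality of \<open>L\<close> they include \<open>u\<close>.\<close>
    let ?A = "{p \<in> L. p x \<in> cl_orbit w}"
    have Lx: "closedin X ((\<lambda>p. p x) ` L)"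
      using image_compactin[OF closedin_compact_space[OF cP clL] ev[OF xS]]
      by (rule compactin_imp_closedin[OF Hausdorff])
    have "act g y \<in> (\<lambda>p. p x) ` L" if "g \<in> carrier K" for g
    proof -
      have "act g y = compose S (act g) u x" using xS by (simp add: compose_def y_def)
      then show ?thesis using Lact[OF that u] by blast
    qed
    then have "cl_orbit y \<subseteq> (\<lambda>p. p x) ` L"
      by (rule orbit_closure_minimal[OF Lx])
    then obtain p where "p \<in> L" "w = p x" using w by blast
    then have "?A \<noteq> {}" using self_in_orbit_closure[OF wX] by blast
    moreover have "closedin P ?A"
    proof -
      have "closedin P (L \<inter> {p \<in> topspace P. p x \<in> cl_orbit w})"
        using closedin_continuous_map_preimage[OF ev[OF xS] closedin_orbit_closure] clL by blast
      moreover have "L \<inter> {p \<in> topspace P. p x \<in> cl_orbit w} = ?A" using LP by blast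
      ultimately show ?thesis by simp
    qed
    moreover have "compose S (act g) q \<in> ?A" if "g \<in> carrier K" "q \<in> ?A" for g q
      using that Lact orbit_closure_invariant[OF wX] xS by (auto simp: compose_def)
    ultimately have "?A \<in> F" using LE by (auto simp: F_def)
    then have "?A = L" using min by blast
    then show "y \<in> cl_orbit w" using u by (auto simp: y_def)
  qed
  ultimately show ?thesis using that by blast
qed

lemma distal_imp_minimal_point:
  assumes "distal_point K X act x" shows "minimal_point x"
proof -
  have "x \<in> topspace X" using assms by (simp add: distal_point_def)
  then obtain y where "y \<in> cl_orbit x" "minimal_point y" "proximal K X act x y"
    by (rule proximal_to_minimal_point)
  then show ?thesis using assms by (auto simp: distal_point_def)
qed

section \<open>Subgroups and factors\<close>

lemma subgroup_action:
  assumes "subgroup N K"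
  shows "compact_metrizable_action (K\<lparr>carrier := N\<rparr>) X act"
proof (rule compact_metrizable_action.intro[OF _ compact_metrizable_action_axioms.intro])
  show "group (K\<lparr>carrier := N\<rparr>)" using assms by (rule subgroup_imp_group)
  have "N \<subseteq> carrier K" using assms by (rule subgroup.subset)
  then show "continuous_map X X (act g)" if "g \<in> carrier (K\<lparr>carrier := N\<rparr>)" for g
    using that continuous_act by auto
  show "act (g \<otimes>\<^bsub>K\<lparr>carrier := N\<rparr>\<^esub> h) x = act g (act h x)"
    if "g \<in> carrier (K\<lparr>carrier := N\<rparr>)" "h \<in> carrier (K\<lparr>carrier := N\<rparr>)" "x \<in> topspace X" for g h x
    using that \<open>N \<subseteq> carrier K\<close> act_mult[of g h x] by auto
  show "act \<one>\<^bsub>K\<lparr>carrier := N\<rparr>\<^esub> x = x" if "x \<in> topspace X" for x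
    using that act_one by simp
qed (fact compact, fact metrizable)

lemma distal_point_subgroup:
  assumes "subgroup N K" "distal_point K X act x"
  shows "distal_point (K\<lparr>carrier := N\<rparr>) X act x"
proof -
  have N: "N \<subseteq> carrier K" using assms(1) by (rule subgroup.subset)
  then have "orbit_closure (K\<lparr>carrier := N\<rparr>) X act x \<subseteq> cl_orbit x"
    unfolding orbit_closure_def by (intro closure_of_mono) auto
  moreover have "proximal K X act x y" if "proximal (K\<lparr>carrier := N\<rparr>) X act x y" for y
    using that N unfolding proximal_def by (auto; blast)
  ultimately show ?thesis
    using assms(2) unfolding distal_point_def by blast
qed

text \<open>
  A point \<open>y\<close> in the orbit closure of \<open>x\<close> and proximal to it projects to such a point for each
  \<open>\<pi> i x\<close>, so distality of all the projections forces \<open>\<pi> i y = \<pi> i x\<close>.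
\<close>

lemma distal_point_of_separating_factors:
  assumes x: "x \<in> topspace X"
    and sep: "\<And>y. y \<in> topspace X \<Longrightarrow> (\<And>i. i \<in> I \<Longrightarrow> \<pi> i y = \<pi> i x) \<Longrightarrow> y = x"
    and Y: "\<And>i. i \<in> I \<Longrightarrow> compact_metrizable_action K (Y i) (acts i)"
    and cont: "\<And>i. i \<in> I \<Longrightarrow> continuous_map X (Y i) (\<pi> i)"
    and equi: "\<And>i g y. i \<in> I \<Longrightarrow> g \<in> carrier K \<Longrightarrow> y \<in> topspace X \<Longrightarrow> \<pi> i (act g y) = acts i g (\<pi> i y)"
    and dist: "\<And>i. i \<in> I \<Longrightarrow> distal_point K (Y i) (acts i) (\<pi> i x)"
  shows "distal_point K X act x"
  unfolding distal_point_def
proof (intro conjI ballI impI x notI)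
  fix y assume y: "y \<in> cl_orbit x" "y \<noteq> x" and prox: "proximal K X act x y"
  have yX: "y \<in> topspace X" using y orbit_closure_subset by blast
  have "\<pi> i y = \<pi> i x" if i: "i \<in> I" for i
  proof -
    interpret Yi: compact_metrizable_action K "Y i" "acts i" using Y[OF i] .
    note c = cont[OF i]
    have "\<pi> i y \<in> Yi.cl_orbit (\<pi> i x)"
    proof -
      have "\<pi> i ` cl_orbit x \<subseteq> Y i closure_of (\<pi> i ` (\<lambda>g. act g x) ` carrier K)"
        unfolding orbit_closure_def by (rule continuous_map_image_closure_subset[OF c])
      also have "\<pi> i ` (\<lambda>g. act g x) ` carrier K = (\<lambda>g. acts i g (\<pi> i x)) ` carrier K"
        using equi[OF i _ x] by (auto simp: image_image)
      finally show ?thesis using y unfolding orbit_closure_def by blast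
    qed
    moreover have "proximal K (Y i) (acts i) (\<pi> i x) (\<pi> i y)"
    proof -
      obtain z where z: "(z, z) \<in> prod_topology X X closure_of pair_orbit x y"
        using prox proximal_iff_closure_meets_diagonal by blast
      let ?f = "\<lambda>(a, b). (\<pi> i a, \<pi> i b)"
      have "continuous_map (prod_topology X X) (prod_topology (Y i) (Y i)) ?f"
        using continuous_map_prod_top[of X X "Y i" "Y i" "\<pi> i" "\<pi> i"] c by blast
      then have "?f ` (prod_topology X X closure_of pair_orbit x y)
          \<subseteq> prod_topology (Y i) (Y i) closure_of (?f ` pair_orbit x y)"
        by (rule continuous_map_image_closure_subset)
      also have "?f ` pair_orbit x y = Yi.pair_orbit (\<pi> i x) (\<pi> i y)"
        using equi[OF i _ x] equi[OF i _ yX] by (auto simp: image_image pair_orbit_def Yi.pair_orbit_def)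
      finally have "(\<pi> i z, \<pi> i z) \<in> prod_topology (Y i) (Y i) closure_of Yi.pair_orbit (\<pi> i x) (\<pi> i y)"
        using z by force
      moreover have "\<pi> i x \<in> topspace (Y i)" "\<pi> i y \<in> topspace (Y i)"
        using c x yX continuous_map_image_subset_topspace by fastforce+
      ultimately show ?thesis
        using Yi.proximal_iff_closure_meets_diagonal by blast
    qed
    ultimately show ?thesis
      using dist[OF i] unfolding distal_point_def by blast
  qed
  then show False using sep[OF yX] y by blast
qed

end

section \<open>Cosets and the normal core\<close>

context group
begin

lemma finite_right_transversal:
  assumes "subgroup H G" "finite (rcosets H)"
  obtains T where "finite T" "T \<subseteq> carrier G" "\<And>g. g \<in> carrier G \<Longrightarrow> \<exists>t\<in>T. \<exists>n\<in>H. g = n \<otimes> t"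
proof
  let ?r = "\<lambda>C. SOME t. t \<in> C"
  have r: "?r (H #> g) \<in> H #> g" if "g \<in> carrier G" for g
    using rcos_self[OF that assms(1)] by (rule someI)
  show "finite (?r ` (rcosets H))"
    using assms(2) by simp
  show "?r ` (rcosets H) \<subseteq> carrier G"
    using r r_coset_subset_G[OF subgroup.subset[OF assms(1)]] by (fastforce simp: RCOSETS_def)
  fix g assume g: "g \<in> carrier G"
  have "g \<in> H #> ?r (H #> g)"
    using repr_independence[OF r[OF g] g assms(1)] rcos_self[OF g assms(1)] by simp
  then obtain n where "n \<in> H" "g = n \<otimes> ?r (H #> g)"
    unfolding r_coset_def by blast
  then show "\<exists>t\<in>?r ` (rcosets H). \<exists>n\<in>H. g = n \<otimes> t"
    using rcosetsI[OF subgroup.subset[OF assms(1)] g] by blast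
qed

text \<open>
  The intersection of the conjugates of \<open>H\<close>, that is, the kernel of the action of \<open>G\<close> on the
  right cosets of \<open>H\<close>.
\<close>

definition normal_core :: "'a set \<Rightarrow> 'a set" where
  "normal_core H = {n \<in> carrier G. \<forall>s\<in>carrier G. s \<otimes> n \<otimes> inv s \<in> H}"

lemma normal_core_subset:
  assumes "subgroup H G" shows "normal_core H \<subseteq> H"
proof
  fix n assume "n \<in> normal_core H"
  then have "n \<in> carrier G" "\<one> \<otimes> n \<otimes> inv \<one> \<in> H"
    unfolding normal_core_def using one_closed by blast+
  then show "n \<in> H" by simp
qed

lemma normal_core_normal:
  assumes "subgroup H G" shows "normal_core H \<lhd> G"
proof -
  interpret H: subgroup H G by fact
  have "subgroup (normal_core H) G"
  proof (rule subgroupI)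
    show "normal_core H \<subseteq> carrier G" by (auto simp: normal_core_def)
    have "\<one> \<in> normal_core H" by (simp add: normal_core_def)
    then show "normal_core H \<noteq> {}" by blast
    fix a assume a: "a \<in> normal_core H"
    then have aG: "a \<in> carrier G" by (simp add: normal_core_def)
    have "s \<otimes> inv a \<otimes> inv s \<in> H" if s: "s \<in> carrier G" for s
    proof -
      have "inv (s \<otimes> a \<otimes> inv s) \<in> H" using a s by (simp add: normal_core_def)
      then show ?thesis using s aG by (simp add: inv_mult_group m_assoc)
    qed
    then show "inv a \<in> normal_core H" using aG by (simp add: normal_core_def)
    fix b assume b: "b \<in> normal_core H"
    then have bG: "b \<in> carrier G" by (simp add: normal_core_def)
    have "s \<otimes> (a \<otimes> b) \<otimes> inv s \<in> H" if s: "s \<in> carrier G" for s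
    proof -
      have "(s \<otimes> a \<otimes> inv s) \<otimes> (s \<otimes> b \<otimes> inv s) \<in> H"
        using a b s by (simp add: normal_core_def)
      moreover have "(s \<otimes> a \<otimes> inv s) \<otimes> (s \<otimes> b \<otimes> inv s) = s \<otimes> (a \<otimes> b) \<otimes> inv s"
        using s aG bG by (simp add: m_assoc inv_solve_left')
      ultimately show ?thesis by simp
    qed
    then show "a \<otimes> b \<in> normal_core H" using aG bG by (simp add: normal_core_def)
  qed
  moreover have "x \<otimes> n \<otimes> inv x \<in> normal_core H"
    if x: "x \<in> carrier G" and n: "n \<in> normal_core H" for x n
  proof -
    have nG: "n \<in> carrier G" using n by (simp add: normal_core_def)
    have "s \<otimes> (x \<otimes> n \<otimes> inv x) \<otimes> inv s \<in> H" if s: "s \<in> carrier G" for s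
    proof -
      have "(s \<otimes> x) \<otimes> n \<otimes> inv (s \<otimes> x) \<in> H"
        using n x s by (simp add: normal_core_def)
      then show ?thesis using x s nG by (simp add: m_assoc inv_mult_group)
    qed
    then show ?thesis using x nG by (simp add: normal_core_def)
  qed
  ultimately show ?thesis
    unfolding normal_inv_iff by blast
qed

text \<open>
  The core is the kernel of the permutation action \<open>\<phi>\<close> on the finitely many cosets of \<open>H\<close>, so its
  cosets are determined by the finitely many values of \<open>\<phi>\<close>.
\<close>

lemma finite_index_normal_core:
  assumes H: "subgroup H G" and fin: "finite (rcosets H)"
  shows "finite (rcosets (normal_core H))"
proof -
  have HG: "H \<subseteq> carrier G" using H by (rule subgroup.subset)
  have N: "subgroup (normal_core H) G"
    using normal_core_normal[OF H] by (simp add: normal_inv_iff)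
  define \<phi> where "\<phi> g = (\<lambda>C\<in>rcosets H. C #> g)" for g
  have "\<phi> ` carrier G \<subseteq> (\<Pi>\<^sub>E C\<in>rcosets H. rcosets H)"
  proof (intro image_subsetI)
    fix g assume g: "g \<in> carrier G"
    have "C #> g \<in> rcosets H" if "C \<in> rcosets H" for C
    proof -
      obtain s where s: "s \<in> carrier G" "C = H #> s"
        using \<open>C \<in> rcosets H\<close> unfolding RCOSETS_def by blast
      then show ?thesis
        using coset_mult_assoc[OF HG s(1) g] rcosetsI[OF HG, of "s \<otimes> g"] g by simp
    qed
    then show "\<phi> g \<in> (\<Pi>\<^sub>E C\<in>rcosets H. rcosets H)"
      unfolding \<phi>_def by (simp add: restrict_PiE_iff)
  qed
  then have fin_\<phi>: "finite (\<phi> ` carrier G)"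
    using finite_PiE[OF fin, of "\<lambda>_. rcosets H"] fin by (blast intro: finite_subset)
  have same_coset: "normal_core H #> g = normal_core H #> g'"
    if g: "g \<in> carrier G" "g' \<in> carrier G" and eq: "\<phi> g = \<phi> g'" for g g'
  proof -
    have "s \<otimes> (g \<otimes> inv g') \<otimes> inv s \<in> H" if s: "s \<in> carrier G" for s
    proof -
      have "(H #> s) #> g = (H #> s) #> g'"
        using fun_cong[OF eq, of "H #> s"] rcosetsI[OF HG s] by (simp add: \<phi>_def)
      then have "H #> (s \<otimes> g) = H #> (s \<otimes> g')"
        using s g HG by (simp add: coset_mult_assoc)
      then have "s \<otimes> g \<in> H #> (s \<otimes> g')"
        using rcos_self[of "s \<otimes> g", OF _ H] s g by simp
      then obtain h where h: "h \<in> H" "s \<otimes> g = h \<otimes> (s \<otimes> g')"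
        by (auto simp: r_coset_def)
      have hG: "h \<in> carrier G" using h HG by blast
      have "s \<otimes> (g \<otimes> inv g') \<otimes> inv s = (s \<otimes> g) \<otimes> inv (s \<otimes> g')"
        using s g by (simp add: m_assoc inv_mult_group)
      also have "\<dots> = h"
        unfolding h(2) using s g hG by (simp add: m_assoc)
      finally show ?thesis using h by simp
    qed
    then have "g \<otimes> inv g' \<in> normal_core H"
      using g by (simp add: normal_core_def)
    then have "normal_core H #> (g \<otimes> inv g') = normal_core H"
      using coset_join2[OF _ N] g by simp
    then show ?thesis
      using coset_mult_inv1 g subgroup.subset[OF N] by blast
  qed
  have "rcosets (normal_core H) \<subseteq> (\<lambda>f. normal_core H #> inv_into (carrier G) \<phi> f) ` \<phi> ` carrier G"
  proof (intro subsetI)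
    fix C assume "C \<in> rcosets (normal_core H)"
    then obtain g where g: "g \<in> carrier G" "C = normal_core H #> g"
      unfolding RCOSETS_def by blast
    have \<phi>g: "\<phi> g \<in> \<phi> ` carrier G" using g by blast
    have "normal_core H #> g = normal_core H #> inv_into (carrier G) \<phi> (\<phi> g)"
      using same_coset[OF g(1) inv_into_into[OF \<phi>g]] f_inv_into_f[OF \<phi>g] by simp
    then show "C \<in> (\<lambda>f. normal_core H #> inv_into (carrier G) \<phi> f) ` \<phi> ` carrier G"
      using g \<phi>g by blast
  qed
  with fin_\<phi> show ?thesis
    by (rule finite_surj)
qed

text \<open>
  A point of \<open>2\<^sup>G\<close> will be glued from points prescribed separately on the left cosets of \<open>H\<close>;
  constancy of \<open>\<rho>\<close> on each coset makes the glued point restrict to the prescribed ones.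
\<close>

lemma left_coset_representative:
  assumes H: "subgroup H G"
  obtains \<rho> where "\<And>g. g \<in> carrier G \<Longrightarrow> \<rho> g \<in> carrier G"
    "\<And>g. g \<in> carrier G \<Longrightarrow> inv (\<rho> g) \<otimes> g \<in> H"
    "\<And>g h. g \<in> carrier G \<Longrightarrow> h \<in> H \<Longrightarrow> \<rho> (\<rho> g \<otimes> h) = \<rho> g"
proof
  interpret H: subgroup H G by fact
  define \<rho> where "\<rho> g = (SOME t. t \<in> g <# H)" for g
  have self: "g \<in> g <# H" if "g \<in> carrier G" for g
    using r_one[OF that] H.one_closed unfolding l_coset_def by (metis UN_I singletonI)
  have r: "\<rho> g \<in> g <# H" if "g \<in> carrier G" for g
    unfolding \<rho>_def using self[OF that] by (rule someI)
  show rG: "\<rho> g \<in> carrier G" if "g \<in> carrier G" for g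
    using r[OF that] that by (auto simp: l_coset_def)
  have eq: "g <# H = \<rho> g <# H" if "g \<in> carrier G" for g
    using l_repr_independence[OF r[OF that] that H] .
  show "inv (\<rho> g) \<otimes> g \<in> H" if g: "g \<in> carrier G" for g
  proof -
    have "g \<in> \<rho> g <# H"
      unfolding eq[OF g, symmetric] using g by (rule self)
    then obtain h where "h \<in> H" "g = \<rho> g \<otimes> h" by (auto simp: l_coset_def)
    then show ?thesis
      using rG[OF g] g by (metis H.mem_carrier inv_solve_left')
  qed
  show "\<rho> (\<rho> g \<otimes> h) = \<rho> g" if g: "g \<in> carrier G" and h: "h \<in> H" for g h
  proof -
    have "\<rho> g \<otimes> h \<in> \<rho> g <# H" using h by (auto simp: l_coset_def)
    then have "\<rho> g <# H = (\<rho> g \<otimes> h) <# H"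
      using l_repr_independence rG[OF g] H by blast
    then have same: "(\<rho> g \<otimes> h) <# H = g <# H"
      using eq[OF g] by metis
    show ?thesis
      unfolding \<rho>_def[of "\<rho> g \<otimes> h"] same by (rule \<rho>_def[symmetric])
  qed
qed

end

section \<open>Distality for a subgroup of finite index\<close>

context compact_metrizable_action
begin

text \<open>
  Since \<open>s n x = (s n s\<^sup>-\<^sup>1) s x\<close>, a normal subgroup lets a translation carry orbits to orbits.
\<close>

lemma translate_orbit_closure_normal:
  assumes N: "N \<lhd> K" and s: "s \<in> carrier K" and x: "x \<in> topspace X"
    and y: "y \<in> orbit_closure (K\<lparr>carrier := N\<rparr>) X act x"
  shows "act s y \<in> orbit_closure (K\<lparr>carrier := N\<rparr>) X act (act s x)"
proof -
  interpret N: normal N K by fact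
  have "act s ` (X closure_of ((\<lambda>g. act g x) ` N)) \<subseteq> X closure_of (act s ` (\<lambda>g. act g x) ` N)"
    by (rule continuous_map_image_closure_subset[OF continuous_act[OF s]])
  also have "\<dots> \<subseteq> X closure_of ((\<lambda>g. act g (act s x)) ` N)"
  proof (rule closure_of_mono, clarify)
    fix n assume n: "n \<in> N"
    have nK: "n \<in> carrier K" using n by (rule N.mem_carrier)
    have "act s (act n x) = act (s \<otimes> n \<otimes> inv s \<otimes> s) x"
      using s nK x by (simp add: act_mult m_assoc)
    also have "\<dots> = act (s \<otimes> n \<otimes> inv s) (act s x)"
      using s nK x by (subst act_mult) auto
    finally show "act s (act n x) \<in> (\<lambda>g. act g (act s x)) ` N"
      using N.inv_op_closed2[OF s n] by blast
  qed
  finally show ?thesis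
    using y unfolding orbit_closure_def by auto
qed

text \<open>
  Translation by \<open>s\<close> is a homeomorphism carrying the orbit closure of \<open>x\<close> onto that of \<open>s x\<close>, so
  the latter is minimal too, and every point of a minimal set is a minimal point.
\<close>

lemma minimal_point_translate_normal:
  assumes N: "N \<lhd> K" and s: "s \<in> carrier K"
    and x: "compact_metrizable_action.minimal_point (K\<lparr>carrier := N\<rparr>) X act x"
    and y: "y \<in> orbit_closure (K\<lparr>carrier := N\<rparr>) X act (act s x)"
  shows "compact_metrizable_action.minimal_point (K\<lparr>carrier := N\<rparr>) X act y"
proof -
  have sub: "subgroup N K" using N by (simp add: normal_inv_iff)
  interpret N: compact_metrizable_action "K\<lparr>carrier := N\<rparr>" X act
    using sub by (rule subgroup_action)
  note xmin = x[unfolded N.minimal_point_def]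
  have xX: "x \<in> topspace X" using xmin by blast
  have yX: "y \<in> topspace X" using y N.orbit_closure_subset by blast
  have s': "inv s \<in> carrier K" using s by simp
  have cancel: "act s (act (inv s) z) = z" if "z \<in> topspace X" for z
    using act_inv_cancel[OF s'] s that by simp
  let ?y = "act (inv s) y"
  have y': "?y \<in> N.cl_orbit x"
    using translate_orbit_closure_normal[OF N s' act_closed[OF s xX] y] act_inv_cancel[OF s xX] by simp
  have "y \<in> N.cl_orbit w" if w: "w \<in> N.cl_orbit y" for w
  proof -
    have wX: "w \<in> topspace X" using w N.orbit_closure_subset by blast
    let ?w = "act (inv s) w"
    have wX': "?w \<in> topspace X" using act_closed s' wX by blast
    have "?w \<in> N.cl_orbit ?y"
      using translate_orbit_closure_normal[OF N s' yX w] .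
    then have "?w \<in> N.cl_orbit x"
      using N.orbit_closure_trans[OF xX y'] by blast
    then have "x \<in> N.cl_orbit ?w"
      using xmin by blast
    then have "?y \<in> N.cl_orbit ?w"
      using N.orbit_closure_trans[OF wX'] y' by blast
    then show ?thesis
      using translate_orbit_closure_normal[OF N s wX'] cancel wX yX by metis
  qed
  then show ?thesis
    using yX by (simp add: N.minimal_point_def)
qed

text \<open>
  The orbit of \<open>x\<close> is the union of the \<open>N\<close>-orbits of finitely many translates \<open>t x\<close>, and closure
  commutes with finite unions.
\<close>

lemma orbit_closure_finite_index:
  assumes N: "subgroup N K" "finite (rcosets N)"
    and x: "x \<in> topspace X" and y: "y \<in> cl_orbit x"
  obtains s where "s \<in> carrier K" "y \<in> orbit_closure (K\<lparr>carrier := N\<rparr>) X act (act s x)"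
proof -
  obtain T where T: "finite T" "T \<subseteq> carrier K"
    and cover: "\<And>g. g \<in> carrier K \<Longrightarrow> \<exists>t\<in>T. \<exists>n\<in>N. g = n \<otimes> t"
    using finite_right_transversal[OF N] by blast
  have NK: "N \<subseteq> carrier K" using N(1) by (rule subgroup.subset)
  let ?A = "(\<lambda>t. (\<lambda>n. act n (act t x)) ` N) ` T"
  have "(\<lambda>g. act g x) ` carrier K \<subseteq> \<Union>?A"
  proof clarify
    fix g assume "g \<in> carrier K"
    then obtain t n where "t \<in> T" "n \<in> N" "g = n \<otimes> t" using cover by blast
    then show "act g x \<in> \<Union>?A"
      using T NK x act_mult[of n t x] by auto
  qed
  then have "y \<in> X closure_of \<Union>?A"
    using y closure_of_mono unfolding orbit_closure_def by blast
  then have "y \<in> (\<Union>S\<in>?A. X closure_of S)"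
    using closure_of_Union[of ?A X] T by simp
  then show ?thesis
    using that T by (auto simp: orbit_closure_def)
qed

text \<open>
  Every group element has the form \<open>t\<^sup>-\<^sup>1 n\<close> with \<open>n \<in> N\<close> and \<open>t\<close> from a finite set \<open>T\<close>. So the orbit
  of \<open>(x, y)\<close> is a finite union of translates of its \<open>N\<close>-orbit; one of them accumulates at the
  diagonal, and translating back by \<open>t\<close> preserves the diagonal.
\<close>

lemma proximal_finite_index:
  assumes N: "subgroup N K" "finite (rcosets N)"
    and prox: "proximal K X act x y"
  shows "proximal (K\<lparr>carrier := N\<rparr>) X act x y"
proof -
  interpret N: compact_metrizable_action "K\<lparr>carrier := N\<rparr>" X act
    using N(1) by (rule subgroup_action)
  interpret sub: subgroup N K by fact
  obtain T where T: "finite T" "T \<subseteq> carrier K"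
    and cover: "\<And>g. g \<in> carrier K \<Longrightarrow> \<exists>t\<in>T. \<exists>n\<in>N. g = n \<otimes> t"
    using finite_right_transversal[OF N] by blast
  obtain z where x: "x \<in> topspace X" and y: "y \<in> topspace X"
    and z: "(z, z) \<in> prod_topology X X closure_of pair_orbit x y"
    using prox proximal_iff_closure_meets_diagonal by blast
  let ?f = "\<lambda>t (a, b). (act t a, act t b)"
  let ?A = "(\<lambda>t. ?f (inv t) ` N.pair_orbit x y) ` T"
  have "pair_orbit x y \<subseteq> \<Union>?A"
  proof
    fix p assume "p \<in> pair_orbit x y"
    then obtain g where g: "g \<in> carrier K" "p = (act g x, act g y)" by (auto simp: pair_orbit_def)
    obtain t n where tn: "t \<in> T" "n \<in> N" "inv g = n \<otimes> t" using cover g by (meson inv_closed)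
    have tK: "t \<in> carrier K" "n \<in> carrier K" using tn T by auto
    then have "g = inv t \<otimes> inv n"
      using arg_cong[OF tn(3), of "\<lambda>a. inv a"] g by (simp add: inv_mult_group)
    then have "p = ?f (inv t) (act (inv n) x, act (inv n) y)"
      using g tK x y by (simp add: act_mult)
    moreover have "(act (inv n) x, act (inv n) y) \<in> N.pair_orbit x y"
      using tn by (auto simp: N.pair_orbit_def)
    ultimately show "p \<in> \<Union>?A" using tn by blast
  qed
  then have "(z, z) \<in> prod_topology X X closure_of \<Union>?A"
    using z closure_of_mono by blast
  then have "(z, z) \<in> (\<Union>S\<in>?A. prod_topology X X closure_of S)"
    using closure_of_Union[of ?A "prod_topology X X"] T by simp
  then obtain t where t: "t \<in> T"
    and zt: "(z, z) \<in> prod_topology X X closure_of (?f (inv t) ` N.pair_orbit x y)" by blast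
  have tK: "t \<in> carrier K" using t T by blast
  have "continuous_map (prod_topology X X) (prod_topology X X) (?f t)"
    using continuous_map_prod_top[of X X X X "act t" "act t"] continuous_act[OF tK] by blast
  then have "?f t ` (prod_topology X X closure_of (?f (inv t) ` N.pair_orbit x y))
      \<subseteq> prod_topology X X closure_of (?f t ` ?f (inv t) ` N.pair_orbit x y)"
    by (rule continuous_map_image_closure_subset)
  also have "?f t ` ?f (inv t) ` N.pair_orbit x y = N.pair_orbit x y"
  proof -
    have "act t (act (inv t) a) = a" if "a \<in> topspace X" for a
      using act_inv_cancel[of "inv t" a] tK that by simp
    then have "?f t (?f (inv t) p) = p" if "p \<in> N.pair_orbit x y" for p
      using that act_closed x y by (auto simp: N.pair_orbit_def)
    then show ?thesis by (simp add: image_image)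
  qed
  finally have "(act t z, act t z) \<in> prod_topology X X closure_of N.pair_orbit x y"
    using zt by fast
  then show ?thesis
    using x y N.proximal_iff_closure_meets_diagonal by blast
qed

lemma proximal_imp_common_limit:
  assumes "proximal K X act x y"
  obtains z where "z \<in> cl_orbit x" "z \<in> cl_orbit y"
proof -
  obtain z where z: "(z, z) \<in> prod_topology X X closure_of pair_orbit x y"
    using assms proximal_iff_closure_meets_diagonal by blast
  have "fst ` (prod_topology X X closure_of pair_orbit x y) \<subseteq> X closure_of (fst ` pair_orbit x y)"
    by (rule continuous_map_image_closure_subset[OF continuous_map_fst])
  moreover have "snd ` (prod_topology X X closure_of pair_orbit x y) \<subseteq> X closure_of (snd ` pair_orbit x y)"
    by (rule continuous_map_image_closure_subset[OF continuous_map_snd])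
  ultimately have "z \<in> cl_orbit x" "z \<in> cl_orbit y"
    using z by (force simp: pair_orbit_def image_image orbit_closure_def)+
  then show ?thesis using that by blast
qed

text \<open>
  Both \<open>x\<close> and any competitor \<open>y\<close> are \<open>N\<close>-minimal, and by proximality their \<open>N\<close>-orbit closures
  share a point; hence these closures are equal and distality for \<open>N\<close> applies to \<open>y\<close>.
\<close>

lemma distal_point_of_finite_index_normal:
  assumes N: "N \<lhd> K" "finite (rcosets N)"
    and dist: "distal_point (K\<lparr>carrier := N\<rparr>) X act x"
  shows "distal_point K X act x"
proof -
  have sub: "subgroup N K" using N by (simp add: normal_inv_iff)
  interpret N: compact_metrizable_action "K\<lparr>carrier := N\<rparr>" X act
    using sub by (rule subgroup_action)
  have x: "x \<in> topspace X" using dist by (simp add: distal_point_def)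
  have xmin: "N.minimal_point x" using dist by (rule N.distal_imp_minimal_point)
  have "y = x" if y: "y \<in> cl_orbit x" and prox: "proximal K X act x y" for y
  proof -
    have yX: "y \<in> topspace X" using y orbit_closure_subset by blast
    have proxN: "proximal (K\<lparr>carrier := N\<rparr>) X act x y"
      using proximal_finite_index[OF sub N(2) prox] .
    obtain s where "s \<in> carrier K" "y \<in> N.cl_orbit (act s x)"
      using orbit_closure_finite_index[OF sub N(2) x y] .
    then have ymin: "N.minimal_point y"
      using minimal_point_translate_normal[OF N(1) _ xmin] by blast
    obtain z where z: "z \<in> N.cl_orbit x" "z \<in> N.cl_orbit y"
      using N.proximal_imp_common_limit[OF proxN] .
    have "x \<in> N.cl_orbit z"
      using xmin z unfolding N.minimal_point_def by blast
    then have "x \<in> N.cl_orbit y"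
      using N.orbit_closure_trans[OF yX z(2)] by blast
    then have "y \<in> N.cl_orbit x"
      using ymin unfolding N.minimal_point_def by blast
    then show ?thesis
      using dist proxN unfolding distal_point_def by blast
  qed
  then show ?thesis
    using x unfolding distal_point_def by blast
qed

lemma distal_point_of_finite_index:
  assumes H: "subgroup H K" and fin: "finite (rcosets H)"
    and dist: "distal_point (K\<lparr>carrier := H\<rparr>) X act x"
  shows "distal_point K X act x"
proof -
  interpret H: compact_metrizable_action "K\<lparr>carrier := H\<rparr>" X act
    using H by (rule subgroup_action)
  have "subgroup (normal_core H) (K\<lparr>carrier := H\<rparr>)"
    using normal_core_normal[OF H] normal_core_subset[OF H] H
    by (simp add: normal_inv_iff subgroup_incl)
  then have "distal_point (K\<lparr>carrier := normal_core H\<rparr>) X act x"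
    using H.distal_point_subgroup[OF _ dist] by fastforce
  then show ?thesis
    using distal_point_of_finite_index_normal normal_core_normal[OF H] finite_index_normal_core[OF H fin]
    by blast
qed

end

section \<open>The Bernoulli shift\<close>

lemma topspace_bernoulli_space: "topspace (bernoulli_space K) = (\<Pi>\<^sub>E h\<in>carrier K. UNIV)"
  by (simp add: bernoulli_space_def)

lemma bernoulli_action:
  assumes "group K" "countable (carrier K)"
  shows "compact_metrizable_action K (bernoulli_space K) (bernoulli_shift K)"
proof -
  interpret group K by fact
  show ?thesis
  proof
    show "compact_space (bernoulli_space K)"
      by (simp add: bernoulli_space_def compact_space_product_topology compact_space_discrete_topology)
    show "metrizable_space (bernoulli_space K)"
      unfolding bernoulli_space_def metrizable_space_product_topology
      using assms(2) by simp
    show "continuous_map (bernoulli_space K) (bernoulli_space K) (bernoulli_shift K g)"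
      if "g \<in> carrier K" for g
      unfolding bernoulli_space_def bernoulli_shift_def continuous_map_componentwise
      using that by (auto intro!: continuous_map_product_projection)
    show "bernoulli_shift K (g \<otimes>\<^bsub>K\<^esub> h) x = bernoulli_shift K g (bernoulli_shift K h x)"
      if "g \<in> carrier K" "h \<in> carrier K" for g h x
      using that by (auto simp: bernoulli_shift_def m_assoc intro!: restrict_ext)
    show "bernoulli_shift K \<one>\<^bsub>K\<^esub> x = x" if "x \<in> topspace (bernoulli_space K)" for x
    proof
      show "bernoulli_shift K \<one>\<^bsub>K\<^esub> x h = x h" for h
        using PiE_arb[of x "carrier K" "\<lambda>_. UNIV" h] that
        by (cases "h \<in> carrier K") (simp_all add: bernoulli_shift_def topspace_bernoulli_space)
    qed
  qed
qed

text \<open>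
  Restriction to a left coset \<open>t H\<close>, read through \<open>h \<mapsto> t h\<close>, is an \<open>H\<close>-equivariant map from
  \<open>2\<^sup>G\<close> to \<open>2\<^sup>H\<close>, and the restrictions to all left cosets determine the point.
\<close>

lemma distal_point_of_coset_restrictions:
  assumes G: "group G" "countable (carrier G)" and H: "subgroup H G" "finite (rcosets\<^bsub>G\<^esub> H)"
    and x: "x \<in> topspace (bernoulli_space G)"
    and R: "R \<subseteq> carrier G" "\<And>g. g \<in> carrier G \<Longrightarrow> \<exists>t\<in>R. \<exists>h\<in>H. g = t \<otimes>\<^bsub>G\<^esub> h"
    and dist: "\<And>t. t \<in> R \<Longrightarrow> distal_point (G\<lparr>carrier := H\<rparr>) (bernoulli_space (G\<lparr>carrier := H\<rparr>))
      (bernoulli_shift (G\<lparr>carrier := H\<rparr>)) (\<lambda>h\<in>H. x (t \<otimes>\<^bsub>G\<^esub> h))"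
  shows "distal_point G (bernoulli_space G) (bernoulli_shift G) x"
proof -
  interpret G: compact_metrizable_action G "bernoulli_space G" "bernoulli_shift G"
    using G by (rule bernoulli_action)
  interpret sub: subgroup H G by fact
  let ?H = "G\<lparr>carrier := H\<rparr>"
  interpret GH: compact_metrizable_action ?H "bernoulli_space G" "bernoulli_shift G"
    using H(1) by (rule G.subgroup_action)
  have HH: "compact_metrizable_action ?H (bernoulli_space ?H) (bernoulli_shift ?H)"
    using G.subgroup_imp_group[OF H(1)] countable_subset[OF sub.subset G(2)]
    by (intro bernoulli_action) auto
  have "distal_point ?H (bernoulli_space G) (bernoulli_shift G) x"
  proof (rule GH.distal_point_of_separating_factors[where I = R and \<pi> = "\<lambda>t x. \<lambda>h\<in>H. x (t \<otimes>\<^bsub>G\<^esub> h)", OF x _ HH])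
    fix y assume y: "y \<in> topspace (bernoulli_space G)"
      and eq: "\<And>t. t \<in> R \<Longrightarrow> (\<lambda>h\<in>H. y (t \<otimes>\<^bsub>G\<^esub> h)) = (\<lambda>h\<in>H. x (t \<otimes>\<^bsub>G\<^esub> h))"
    show "y = x"
    proof (rule PiE_ext)
      show "y \<in> (\<Pi>\<^sub>E h\<in>carrier G. UNIV)" "x \<in> (\<Pi>\<^sub>E h\<in>carrier G. UNIV)"
        using x y by (simp_all add: topspace_bernoulli_space)
      fix g assume "g \<in> carrier G"
      then obtain t h where "t \<in> R" "h \<in> H" "g = t \<otimes>\<^bsub>G\<^esub> h" using R by blast
      then show "y g = x g" using fun_cong[OF eq, of t h] by simp
    qed
  next
    fix t assume t: "t \<in> R"
    then have tG: "t \<in> carrier G" using R by blast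
    show "continuous_map (bernoulli_space G) (bernoulli_space ?H) (\<lambda>x. \<lambda>h\<in>H. x (t \<otimes>\<^bsub>G\<^esub> h))"
      unfolding bernoulli_space_def continuous_map_componentwise
      using tG by (auto intro!: continuous_map_product_projection)
    show "(\<lambda>h\<in>H. bernoulli_shift G g y (t \<otimes>\<^bsub>G\<^esub> h)) = bernoulli_shift ?H g (\<lambda>h\<in>H. y (t \<otimes>\<^bsub>G\<^esub> h))"
      if "g \<in> carrier ?H" for g y
      using that tG by (auto simp: bernoulli_shift_def G.m_assoc intro!: restrict_ext)
    show "distal_point ?H (bernoulli_space ?H) (bernoulli_shift ?H) (\<lambda>h\<in>H. x (t \<otimes>\<^bsub>G\<^esub> h))"
      using t by (rule dist)
  qed
  then show ?thesis
    by (rule G.distal_point_of_finite_index[OF H])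
qed

theorem theorem6p1:
  fixes G :: "('g, 'm) monoid_scheme" and H :: "'g set"
  assumes "group G"
    and "countable (carrier G)"
    and "infinite (carrier G)"
    and "subgroup H G"
    and "finite (rcosets\<^bsub>G\<^esub> H)"
    and "distal_points_dense (G\<lparr>carrier := H\<rparr>) (bernoulli_space (G\<lparr>carrier := H\<rparr>))
           (bernoulli_shift (G\<lparr>carrier := H\<rparr>))"
  shows "distal_points_dense G (bernoulli_space G) (bernoulli_shift G)"
  unfolding distal_points_dense_def dense_intersects_open
proof (intro allI impI, elim conjE)
  interpret G: group G by fact
  interpret H: subgroup H G by fact
  let ?H = "G\<lparr>carrier := H\<rparr>"
  fix U assume U: "openin (bernoulli_space G) U" "U \<noteq> {}"
  then obtain a where "a \<in> U" by blast
  then obtain V where finV: "finite {g \<in> carrier G. V g \<noteq> UNIV}"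
    and a: "a \<in> (\<Pi>\<^sub>E g\<in>carrier G. V g)" and VU: "(\<Pi>\<^sub>E g\<in>carrier G. V g) \<subseteq> U"
    using U(1) unfolding bernoulli_space_def openin_product_topology_alt by fastforce
  \<comment> \<open>The part of the cylinder lying over the coset \<open>t H\<close> is a nonempty cylinder in \<open>2\<^sup>H\<close>.\<close>
  have "\<exists>x. distal_point ?H (bernoulli_space ?H) (bernoulli_shift ?H) x \<and> x \<in> (\<Pi>\<^sub>E h\<in>H. V (t \<otimes>\<^bsub>G\<^esub> h))"
    if t: "t \<in> carrier G" for t
  proof -
    let ?W = "\<Pi>\<^sub>E h\<in>H. V (t \<otimes>\<^bsub>G\<^esub> h)"
    have "inj_on (\<lambda>h. t \<otimes>\<^bsub>G\<^esub> h) {h \<in> H. V (t \<otimes>\<^bsub>G\<^esub> h) \<noteq> UNIV}"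
      using t by (auto simp: inj_on_def)
    moreover have "(\<lambda>h. t \<otimes>\<^bsub>G\<^esub> h) ` {h \<in> H. V (t \<otimes>\<^bsub>G\<^esub> h) \<noteq> UNIV} \<subseteq> {g \<in> carrier G. V g \<noteq> UNIV}"
      using t by auto
    ultimately have "finite {h \<in> H. V (t \<otimes>\<^bsub>G\<^esub> h) \<noteq> UNIV}"
      using finV by (blast intro: inj_on_finite)
    then have "openin (bernoulli_space ?H) ?W"
      by (simp add: bernoulli_space_def openin_PiE_gen)
    moreover have "(\<lambda>h\<in>H. a (t \<otimes>\<^bsub>G\<^esub> h)) \<in> ?W"
      using a t by auto
    ultimately have "{x. distal_point ?H (bernoulli_space ?H) (bernoulli_shift ?H) x} \<inter> ?W \<noteq> {}"
      using assms(6) unfolding distal_points_dense_def dense_intersects_open by blast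
    then show ?thesis by blast
  qed
  then obtain c where
    c: "\<And>t. t \<in> carrier G \<Longrightarrow> distal_point ?H (bernoulli_space ?H) (bernoulli_shift ?H) (c t)"
    and cV: "\<And>t. t \<in> carrier G \<Longrightarrow> c t \<in> (\<Pi>\<^sub>E h\<in>H. V (t \<otimes>\<^bsub>G\<^esub> h))"
    by metis
  obtain \<rho> where \<rho>G: "\<And>g. g \<in> carrier G \<Longrightarrow> \<rho> g \<in> carrier G"
    and \<rho>H: "\<And>g. g \<in> carrier G \<Longrightarrow> inv\<^bsub>G\<^esub> (\<rho> g) \<otimes>\<^bsub>G\<^esub> g \<in> H"
    and \<rho>_const: "\<And>g h. g \<in> carrier G \<Longrightarrow> h \<in> H \<Longrightarrow> \<rho> (\<rho> g \<otimes>\<^bsub>G\<^esub> h) = \<rho> g"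
    using G.left_coset_representative[OF assms(4)] by blast
  have split: "\<rho> g \<otimes>\<^bsub>G\<^esub> (inv\<^bsub>G\<^esub> (\<rho> g) \<otimes>\<^bsub>G\<^esub> g) = g" if "g \<in> carrier G" for g
    using that \<rho>G[OF that] by (simp add: G.m_assoc[symmetric])
  \<comment> \<open>Glue the distal points \<open>c t\<close>, one placed on each left coset.\<close>
  define x where "x = (\<lambda>g\<in>carrier G. c (\<rho> g) (inv\<^bsub>G\<^esub> (\<rho> g) \<otimes>\<^bsub>G\<^esub> g))"
  have xV: "x \<in> (\<Pi>\<^sub>E g\<in>carrier G. V g)"
  proof (rule PiE_I)
    fix g assume g: "g \<in> carrier G"
    have "c (\<rho> g) (inv\<^bsub>G\<^esub> (\<rho> g) \<otimes>\<^bsub>G\<^esub> g) \<in> V (\<rho> g \<otimes>\<^bsub>G\<^esub> (inv\<^bsub>G\<^esub> (\<rho> g) \<otimes>\<^bsub>G\<^esub> g))"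
      using PiE_mem[OF cV[OF \<rho>G[OF g]] \<rho>H[OF g]] .
    then show "x g \<in> V g"
      using g by (simp add: x_def split)
  qed (simp add: x_def)
  have "distal_point G (bernoulli_space G) (bernoulli_shift G) x"
  proof (rule distal_point_of_coset_restrictions[OF assms(1,2,4,5), where R = "\<rho> ` carrier G"])
    show "x \<in> topspace (bernoulli_space G)"
      by (simp add: topspace_bernoulli_space x_def)
    show "\<rho> ` carrier G \<subseteq> carrier G" using \<rho>G by blast
    show "\<exists>t\<in>\<rho> ` carrier G. \<exists>h\<in>H. g = t \<otimes>\<^bsub>G\<^esub> h" if "g \<in> carrier G" for g
      using split[OF that] \<rho>H[OF that] that by (metis imageI)
    fix t assume "t \<in> \<rho> ` carrier G"
    then obtain g where g: "g \<in> carrier G" "t = \<rho> g" by blast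
    have tG: "t \<in> carrier G" using g \<rho>G by blast
    have "(\<lambda>h\<in>H. x (t \<otimes>\<^bsub>G\<^esub> h)) = c t"
    proof
      fix h
      show "(\<lambda>h\<in>H. x (t \<otimes>\<^bsub>G\<^esub> h)) h = c t h"
      proof (cases "h \<in> H")
        case True
        then have "\<rho> (t \<otimes>\<^bsub>G\<^esub> h) = t" using \<rho>_const g by simp
        then show ?thesis
          using True tG by (simp add: x_def G.m_assoc[symmetric])
      next
        case False
        then show ?thesis
          using PiE_arb[OF cV[OF tG]] by simp
      qed
    qed
    then show "distal_point ?H (bernoulli_space ?H) (bernoulli_shift ?H) (\<lambda>h\<in>H. x (t \<otimes>\<^bsub>G\<^esub> h))"
      using c[OF tG] by simp
  qed
  then show "{x. distal_point G (bernoulli_space G) (bernoulli_shift G) x} \<inter> U \<noteq> {}"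
    using xV VU by blast
qed

end
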